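(* Let $A$ be a graded Artinian algebra over a field $\mathsf{k}$ and let $M$ be a finite graded $A$-module with Hilbert function $H(M)$. Then for any linear form $\ell\in A_1$, $$P_{\ell,M}\leq P_c\bigl(H(M)\bigr)$$ in the dominance order on partitions of $\dim_{\mathsf{k}}M$.
   Context: A graded Artinian algebra over $\mathsf{k}$ is a commutative graded ring $A=\bigoplus_{i\ge0}A_i$ with $A_0=\mathsf{k}$ and finite dimension over $\mathsf{k}$ (not necessarily generated in degree one). A finite graded $A$-module $M=\bigoplus_i M_i$ is finite dimensional over $\mathsf{k}$; its Hilbert function is $H(M)=(h_i)$, $h_i=\dim_{\mathsf{k}}M_i$. Jordan type: $P_{\ell,M}$ is the partition of $\dim_{\mathsf{k}}M$ whose parts are the Jordan block sizes of the nilpotent map $m_\ell\colon M\to M$, $x\mapsto\ell x$. Contiguous partition: for a finite sequence $H=(h_0,\dots,h_j)$ of non-negative integers, the bar graph of $H$ has $h_i$ boxes stacked in column $i$. $P_c(H)$ is the partition whose parts are the lengths of the maximal contiguous row segments of the bar graph; i.e. for each row $r\ge1$ decompose $\{i\mid h_i\ge r\}$ into maximal intervals of consecutive integers, and let $P_c(H)$ be the multiset of the cardinalities of all these intervals, over all $r$. Dominance order: $P=(p_1\ge p_2\ge\cdots)\le P'=(p'_1\ge p'_2\ge\cdots)$ (extended by zeros) means $\sum_{k=1}^i p_k\le\sum_{k=1}^i p'_k$ for all $i$. *)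

theory Defs
  imports "HOL-Library.Multiset" "Jordan_Normal_Form.Jordan_Normal_Form"
begin

section \<open>Partitions, dominance order, contiguous partition\<close>

text \<open>A partition is the multiset of its (positive) parts.\<close>

definition partition_of :: "nat \<Rightarrow> nat multiset \<Rightarrow> bool" where
  "partition_of n P \<longleftrightarrow> 0 \<notin># P \<and> sum_mset P = n"

definition parts_desc :: "nat multiset \<Rightarrow> nat list" where
  "parts_desc P = rev (sorted_list_of_multiset P)"

text \<open>For \<open>i\<close> beyond the number of parts, \<open>take\<close> returns the whole list; this is the
  convention that partitions are extended by zeros.\<close>

definition dominance_le :: "nat multiset \<Rightarrow> nat multiset \<Rightarrow> bool" where
  "dominance_le P Q \<longleftrightarrow>
     (\<forall>i. sum_list (take i (parts_desc P)) \<le> sum_list (take i (parts_desc Q)))"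

definition intervals_in :: "int set \<Rightarrow> int set set" where
  "intervals_in S = {I. I \<subseteq> S \<and> (\<exists>a b. a \<le> b \<and> I = {a..b})}"

definition maximal_intervals :: "int set \<Rightarrow> int set set" where
  "maximal_intervals S = {I \<in> intervals_in S. \<forall>J \<in> intervals_in S. I \<subseteq> J \<longrightarrow> J = I}"

text \<open>Meant for finitely supported \<open>h\<close>: the index set of pairs (row, segment) is then finite,
  as \<open>mset_set\<close> requires. A finite sequence \<open>(h\<^sub>0, \<dots>, h\<^sub>j)\<close> is viewed as a function
  on the integers, extended by zero.\<close>

definition contiguous_partition :: "(int \<Rightarrow> nat) \<Rightarrow> nat multiset" where
  "contiguous_partition h =
     image_mset (\<lambda>(r, I). card I) (mset_set (SIGMA r:{1..}. maximal_intervals {i. r \<le> h i}))"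

section \<open>Graded algebras and graded modules\<close>

text \<open>Internal direct sum: every element is, in exactly one way, a finite sum of
  components taken from the summands.\<close>

definition internal_direct_sum :: "('i \<Rightarrow> 'b::ab_group_add set) \<Rightarrow> bool" where
  "internal_direct_sum G \<longleftrightarrow>
     (\<forall>x. \<exists>!u. (\<forall>i. u i \<in> G i) \<and> finite {i. u i \<noteq> 0} \<and> x = (\<Sum>i | u i \<noteq> 0. u i))"

locale graded_artinian_algebra = vector_space scaleA
  for scaleA :: "'k::field \<Rightarrow> 'a::comm_ring_1 \<Rightarrow> 'a" +
  fixes A :: "nat \<Rightarrow> 'a set"
  assumes scaleA_mult: "scaleA c (x * y) = scaleA c x * y"
    and finite_dim: "\<exists>B. finite B \<and> span B = UNIV"
    and subspace_component: "subspace (A i)"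
    and direct_sum: "internal_direct_sum A"
    and mult_component: "x \<in> A i \<Longrightarrow> y \<in> A j \<Longrightarrow> x * y \<in> A (i + j)"
    and component_0: "A 0 = range (\<lambda>c. scaleA c 1)"

text \<open>The parameter \<open>scaleM\<close> is the vector space structure that the module inherits
  from the algebra: \<open>scaleM_compat\<close> with \<open>x = 1\<close> determines it. Degrees of
  module elements are arbitrary integers.\<close>

locale finite_graded_module =
  graded_artinian_algebra scaleA A +
  AM: Modules.module smult +
  V: vector_space scaleM
  for scaleA :: "'k::field \<Rightarrow> 'a::comm_ring_1 \<Rightarrow> 'a"
    and A :: "nat \<Rightarrow> 'a set"
    and smult :: "'a \<Rightarrow> 'm::ab_group_add \<Rightarrow> 'm"
    and scaleM :: "'k \<Rightarrow> 'm \<Rightarrow> 'm" +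
  fixes M :: "int \<Rightarrow> 'm set"
  assumes scaleM_compat: "smult (scaleA c x) m = scaleM c (smult x m)"
    and finite_dim_module: "\<exists>B. finite B \<and> V.span B = UNIV"
    and subspace_module_component: "V.subspace (M j)"
    and direct_sum_module: "internal_direct_sum M"
    and smult_component: "x \<in> A i \<Longrightarrow> m \<in> M j \<Longrightarrow> smult x m \<in> M (int i + j)"

section \<open>Hilbert function and Jordan type\<close>

definition hilbert_function ::
    "('k::field \<Rightarrow> 'm::ab_group_add \<Rightarrow> 'm) \<Rightarrow> (int \<Rightarrow> 'm set) \<Rightarrow> int \<Rightarrow> nat" where
  "hilbert_function scale M i = vector_space.dim scale (M i)"

definition ordered_basis ::
    "('k::field \<Rightarrow> 'm::ab_group_add \<Rightarrow> 'm) \<Rightarrow> 'm list \<Rightarrow> bool" where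
  "ordered_basis scale vs \<longleftrightarrow>
     distinct vs \<and> \<not> module.dependent scale (set vs) \<and> module.span scale (set vs) = UNIV"

definition matrix_of ::
    "('k::field \<Rightarrow> 'm::ab_group_add \<Rightarrow> 'm) \<Rightarrow> 'm list \<Rightarrow> ('m \<Rightarrow> 'm) \<Rightarrow> 'k mat" where
  "matrix_of scale vs f = mat (length vs) (length vs)
     (\<lambda>(i, j). module.representation scale (set vs) (f (vs ! j)) (vs ! i))"

definition is_jordan_type ::
    "('k::field \<Rightarrow> 'm::ab_group_add \<Rightarrow> 'm) \<Rightarrow> ('m \<Rightarrow> 'm) \<Rightarrow> nat multiset \<Rightarrow> bool" where
  "is_jordan_type scale f P \<longleftrightarrow>
     (\<exists>vs n_as. ordered_basis scale vs \<and> 0 \<notin> fst ` set n_as \<and>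
        matrix_of scale vs f = jordan_matrix n_as \<and> P = mset (map fst n_as))"

text \<open>In finite dimension, a nilpotent linear map has exactly one Jordan type.\<close>

definition jordan_type ::
    "('k::field \<Rightarrow> 'm::ab_group_add \<Rightarrow> 'm) \<Rightarrow> ('m \<Rightarrow> 'm) \<Rightarrow> nat multiset" where
  "jordan_type scale f = (THE P. is_jordan_type scale f P)"

end

theory Submission
  imports Defs
begin

text \<open>
  Write \<open>f\<close> for multiplication by \<open>\<ell>\<close>, a map of degree one on the graded space
  \<open>M\<close>, and measure a partition \<open>P\<close> by its excess \<open>\<Sum>p. max (p - i) 0\<close> over each height
  \<open>i\<close>. Both sides of the inequality have an excess with a direct meaning.

  \<^item> A Jordan block of size \<open>p\<close> contributes \<open>max (p - i) 0\<close> to the rank of \<open>f\<^sup>i\<close>, so the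
    excess of the Jordan type over \<open>i\<close> is the rank of \<open>f\<^sup>i\<close> (\<open>jordan_type_nilpotent\<close>).
  \<^item> A row segment of length \<open>q\<close> contains \<open>max (q - i) 0\<close> windows \<open>{d..d+i}\<close>, so the excess of
    the contiguous partition over \<open>i\<close> counts the pairs of a row and a window that lies in this
    row, which is \<open>\<Sum>d. min (h d) \<dots> (h (d+i))\<close> (\<open>excess_contiguous_partition\<close>).

  On the component of degree \<open>d\<close> the map \<open>f\<^sup>i\<close> factors through the components of degrees
  \<open>d, \<dots>, d+i\<close>, so its rank there is at most the minimum of their dimensions. Summing over \<open>d\<close>
  bounds the first excess by the second, for every \<open>i\<close> (\<open>dim_range_funpow_le\<close>). Such a family
  of bounds implies dominance (\<open>dominance_le_if_excess_le\<close>): it says that the conjugate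
  partitions are comparable in the opposite direction.

  The Jordan type is a definite description, so existence and uniqueness of the Jordan form of a
  nilpotent map enter as well. Existence is an induction along the images of the powers of \<open>f\<close>
  (\<open>extend_jordan_basis\<close>); uniqueness holds because the second differences of the excess are the
  multiplicities of the parts (\<open>excess_inject\<close>).
\<close>

section \<open>Excesses and the dominance order\<close>

definition excess :: "nat multiset \<Rightarrow> nat \<Rightarrow> nat" where
  "excess P i = (\<Sum>p\<in>#P. p - i)"

lemma excess_mset: "excess (mset xs) i = (\<Sum>x\<leftarrow>xs. x - i)"
  unfolding excess_def by (metis mset_map sum_mset_sum_list)

lemma take_sum_le_excess:
  "sum_list (take k xs) \<le> (\<Sum>x\<leftarrow>xs. x - i) + k * i" for xs :: "nat list"
proof (induction xs arbitrary: k)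
  case (Cons x xs)
  show ?case
  proof (cases k)
    case (Suc m)
    then show ?thesis using Cons.IH[of m] by simp
  qed simp
qed simp

text \<open>The bound of the previous lemma is attained when the height is the \<open>k\<close>-th part: the earlier
  parts lose exactly this height and the later ones vanish.\<close>

lemma excess_eq_take_sum:
  fixes xs :: "nat list"
  assumes "sorted_wrt (\<ge>) xs" and "k < length xs"
  shows "(\<Sum>x\<leftarrow>xs. x - xs ! k) + k * (xs ! k) = sum_list (take k xs)"
  using assms
proof (induction xs arbitrary: k)
  case (Cons x xs)
  show ?case
  proof (cases k)
    case 0
    then show ?thesis using Cons.prems by (auto simp: sum_list_eq_0_iff)
  next
    case (Suc m)
    then have "xs ! m \<in> set xs" using Cons.prems by auto
    then have "xs ! m \<le> x" using Cons.prems by auto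
    moreover have "sum_list (map (\<lambda>y. y - xs ! m) xs) + m * xs ! m = sum_list (take m xs)"
      using Suc Cons.IH[of m] Cons.prems by simp
    ultimately show ?thesis using Suc by simp
  qed
qed simp

text \<open>Choose the height \<open>i\<close> at which the first \<open>k\<close> parts of \<open>Q\<close> sum to exactly
  \<open>excess Q i + k * i\<close>; the first \<open>k\<close> parts of \<open>P\<close> never sum to more than
  \<open>excess P i + k * i\<close>.\<close>

lemma dominance_le_if_excess_le:
  assumes "\<And>i. excess P i \<le> excess Q i"
  shows "dominance_le P Q"
  unfolding dominance_le_def
proof
  fix k
  let ?p = "parts_desc P" and ?q = "parts_desc Q"
  have ex: "excess P i = (\<Sum>x\<leftarrow>?p. x - i)" "excess Q i = (\<Sum>x\<leftarrow>?q. x - i)" for i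
    using excess_mset[of ?p i] excess_mset[of ?q i] by (simp_all add: parts_desc_def)
  have le: "sum_list (take k ?p) \<le> (\<Sum>x\<leftarrow>?q. x - i) + k * i" for i
    using take_sum_le_excess[of k ?p i] assms[of i] ex by simp
  show "sum_list (take k ?p) \<le> sum_list (take k ?q)"
  proof (cases "k < length ?q")
    case True
    have "sorted_wrt (\<ge>) ?q" by (simp add: parts_desc_def sorted_wrt_rev)
    from excess_eq_take_sum[OF this True] le[of "?q ! k"] show ?thesis by simp
  next
    case False
    \<comment> \<open>Beyond the last part of \<open>Q\<close> only the totals matter, which are the excesses over \<open>0\<close>.\<close>
    then show ?thesis using le[of 0] by simp
  qed
qed

text \<open>As a function of \<open>i\<close>, \<open>p - i\<close> in the natural numbers is piecewise linear with its only kink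
  at \<open>i = p\<close>, so a second difference counts parts.\<close>

lemma count_excess:
  "count P (Suc i) + 2 * excess P (Suc i) = excess P i + excess P (Suc (Suc i))"
  unfolding excess_def by (induction P) auto

lemma excess_inject:
  assumes "0 \<notin># P" "0 \<notin># Q" and "\<And>i. excess P i = excess Q i"
  shows "P = Q"
proof (rule multiset_eqI)
  fix k
  show "count P k = count Q k"
  proof (cases k)
    case 0
    then show ?thesis using assms(1,2) by (simp add: not_in_iff)
  next
    case (Suc i)
    then show ?thesis using count_excess[of P i] count_excess[of Q i] assms(3) by simp
  qed
qed


section \<open>Windows in row segments\<close>

lemma maximal_interval_exists:
  assumes "finite S" and "{d..d + int i} \<subseteq> S"
  shows "\<exists>I\<in>maximal_intervals S. {d..d + int i} \<subseteq> I"
proof -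
  have "finite (intervals_in S)"
    by (rule finite_subset[of _ "Pow S"]) (auto simp: intervals_in_def assms)
  moreover have "{d..d + int i} \<in> intervals_in S"
    using assms(2) by (force simp: intervals_in_def)
  ultimately obtain I where "I \<in> intervals_in S" "{d..d + int i} \<subseteq> I"
    "\<forall>J\<in>intervals_in S. I \<subseteq> J \<longrightarrow> I = J"
    using finite_has_maximal2[of "intervals_in S" "{d..d + int i}"] by blast
  then show ?thesis unfolding maximal_intervals_def by blast
qed

lemma maximal_intervals_disjoint:
  assumes "I \<in> maximal_intervals S" "J \<in> maximal_intervals S" "x \<in> I" "x \<in> J"
  shows "I = J"
proof -
  obtain a b c d where I: "I = {a..b}" "a \<le> b" "I \<subseteq> S" and J: "J = {c..d}" "c \<le> d" "J \<subseteq> S"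
    using assms(1,2) by (auto simp: maximal_intervals_def intervals_in_def)
  have "a \<le> x" "x \<le> b" "c \<le> x" "x \<le> d" using assms(3,4) unfolding I(1) J(1) by simp_all
  then have "y \<in> {a..b} \<union> {c..d} \<longleftrightarrow> y \<in> {min a c..max b d}" for y
    unfolding Un_iff atLeastAtMost_iff by linarith
  then have "I \<union> J = {min a c..max b d}"
    unfolding I(1) J(1) by blast
  moreover have "min a c \<le> max b d" using I(2) by linarith
  moreover have "I \<union> J \<subseteq> S" using I(3) J(3) by (rule Un_least)
  ultimately have "I \<union> J \<in> intervals_in S"
    unfolding intervals_in_def by (intro CollectI conjI exI[of _ "min a c"] exI[of _ "max b d"])
  then have "I \<union> J = I" "I \<union> J = J"
    using assms(1,2) by (simp_all add: maximal_intervals_def)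
  then show ?thesis by simp
qed

lemma card_windows_in_interval:
  "card {d. {d..d + int i} \<subseteq> {a..b}} = card {a..b} - i" if "a \<le> b"
proof -
  have "{d. {d..d + int i} \<subseteq> {a..b}} = {a..b - int i}" by auto
  then show ?thesis by simp
qed

text \<open>Every window in the finite set \<open>S\<close> lies in exactly one maximal interval of \<open>S\<close>.\<close>

lemma card_windows:
  assumes "finite S"
  shows "card {d. {d..d + int i} \<subseteq> S} = (\<Sum>I\<in>maximal_intervals S. card I - i)"
proof -
  let ?W = "\<lambda>T. {d. {d..d + int i} \<subseteq> T}"
  have sub: "I \<subseteq> S" if "I \<in> maximal_intervals S" for I
    using that by (auto simp: maximal_intervals_def intervals_in_def)
  have fin: "finite (maximal_intervals S)"
    by (rule finite_subset[of _ "Pow S"]) (use sub assms in auto)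
  have self: "d \<in> T" if "d \<in> ?W T" for d T using that by auto
  have "?W S = (\<Union>I\<in>maximal_intervals S. ?W I)"
  proof
    show "?W S \<subseteq> (\<Union>I\<in>maximal_intervals S. ?W I)"
      using maximal_interval_exists[OF assms] by blast
    show "(\<Union>I\<in>maximal_intervals S. ?W I) \<subseteq> ?W S" using sub by blast
  qed
  moreover have "card (\<Union>I\<in>maximal_intervals S. ?W I) = (\<Sum>I\<in>maximal_intervals S. card (?W I))"
  proof (rule card_UN_disjoint[OF fin])
    show "\<forall>I\<in>maximal_intervals S. finite (?W I)"
    proof
      fix I assume "I \<in> maximal_intervals S"
      then have "?W I \<subseteq> S" using sub self by blast
      then show "finite (?W I)" using assms finite_subset by blast
    qed
    show "\<forall>I\<in>maximal_intervals S. \<forall>J\<in>maximal_intervals S. I \<noteq> J \<longrightarrow> ?W I \<inter> ?W J = {}"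
      using maximal_intervals_disjoint self by blast
  qed
  moreover have "card (?W I) = card I - i" if I: "I \<in> maximal_intervals S" for I
  proof -
    obtain a b where "a \<le> b" "I = {a..b}"
      using I by (auto simp: maximal_intervals_def intervals_in_def)
    then show ?thesis using card_windows_in_interval by simp
  qed
  ultimately show ?thesis by simp
qed

context
  fixes h :: "int \<Rightarrow> nat"
  assumes finite_support: "finite {d. h d \<noteq> 0}"
begin

lemma finite_row: "finite {d. r \<le> h d}" if "1 \<le> r"
  by (rule finite_subset[OF _ finite_support]) (use that in auto)

lemma row_bound: "\<exists>m. \<forall>r d. r \<le> h d \<longrightarrow> r \<le> m"
proof -
  have "finite (insert 0 (h ` {d. h d \<noteq> 0}))" using finite_support by blast
  then obtain m where m: "\<forall>x\<in>insert 0 (h ` {d. h d \<noteq> 0}). x \<le> m"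
    using finite_nat_set_iff_bounded_le by blast
  have "h d \<le> m" for d using m by (cases "h d = 0") auto
  then show ?thesis using le_trans by blast
qed

lemma finite_segments: "finite (SIGMA r:{1..}. maximal_intervals {d. r \<le> h d})"
proof -
  obtain m where m: "\<And>r d. r \<le> h d \<Longrightarrow> r \<le> m" using row_bound by blast
  have "(SIGMA r:{1..}. maximal_intervals {d. r \<le> h d}) \<subseteq> {1..m} \<times> Pow {d. h d \<noteq> 0}"
  proof clarify
    fix r I assume r: "(r::nat) \<ge> 1" and I: "I \<in> maximal_intervals {d. r \<le> h d}"
    then have "I \<subseteq> {d. r \<le> h d}" "I \<noteq> {}"
      by (auto simp: maximal_intervals_def intervals_in_def)
    then show "r \<in> {1..m} \<and> I \<in> Pow {d. h d \<noteq> 0}" using m r by fastforce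
  qed
  then show ?thesis using finite_support finite_subset by blast
qed

lemma zero_notin_contiguous_partition: "0 \<notin># contiguous_partition h"
proof -
  have "card I \<noteq> 0" if "I \<in> maximal_intervals S" for I and S :: "int set"
    using that by (auto simp: maximal_intervals_def intervals_in_def)
  then show ?thesis using finite_segments by (force simp: contiguous_partition_def)
qed

text \<open>Double counting of the pairs of a row \<open>r\<close> and a degree \<open>d\<close> such that the window \<open>{d..d+i}\<close>
  lies in row \<open>r\<close>: by rows they give the excess, by degrees the minimum of the heights over the
  window. The minimum is kept as the cardinality of the set of admissible rows.\<close>

lemma excess_contiguous_partition:
  "excess (contiguous_partition h) i =
     (\<Sum>d | h d \<noteq> 0. card {r. 1 \<le> r \<and> (\<forall>e\<in>{d..d + int i}. r \<le> h e)})"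
proof -
  obtain m where m: "\<And>r d. r \<le> h d \<Longrightarrow> r \<le> m" using row_bound by blast
  let ?R = "\<lambda>r. {d. r \<le> h d}"
  have finR: "\<forall>r\<in>{1..m}. finite (maximal_intervals (?R r))"
  proof
    fix r assume "r \<in> {1..m}"
    then have "maximal_intervals (?R r) \<subseteq> Pow (?R r)" "finite (?R r)"
      using finite_row by (auto simp: maximal_intervals_def intervals_in_def)
    then show "finite (maximal_intervals (?R r))" using finite_subset by blast
  qed
  have nonempty: "r \<le> m" if "I \<in> maximal_intervals (?R r)" for r I
  proof -
    have "I \<noteq> {}" "I \<subseteq> ?R r" using that by (auto simp: maximal_intervals_def intervals_in_def)
    then show ?thesis using m by blast
  qed
  have seg: "(SIGMA r:{1..}. maximal_intervals (?R r)) = (SIGMA r:{1..m}. maximal_intervals (?R r))"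
    using nonempty by auto
  have "excess (contiguous_partition h) i
      = (\<Sum>(r,I)\<in>(SIGMA r:{1..}. maximal_intervals (?R r)). card I - i)"
    unfolding excess_def contiguous_partition_def sum_unfold_sum_mset
    by (simp add: image_mset.compositionality o_def case_prod_unfold)
  also have "\<dots> = (\<Sum>r\<in>{1..m}. \<Sum>I\<in>maximal_intervals (?R r). card I - i)"
    unfolding seg using finR by (subst sum.Sigma) auto
  also have "\<dots> = (\<Sum>r\<in>{1..m}. card {d. {d..d + int i} \<subseteq> ?R r})"
    by (rule sum.cong[OF refl]) (simp add: card_windows finite_row)
  also have "\<dots> = (\<Sum>r\<in>{1..m}. card {d\<in>{d. h d \<noteq> 0}. {d..d + int i} \<subseteq> ?R r})"
  proof (rule sum.cong[OF refl])
    fix r assume r: "r \<in> {1..m}"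
    have "h d \<noteq> 0" if "{d..d + int i} \<subseteq> ?R r" for d
    proof -
      have "d \<in> ?R r" using that by (meson atLeastAtMost_iff le_add_same_cancel1 of_nat_0_le_iff order_refl subsetD)
      then show ?thesis using r by auto
    qed
    then show "card {d. {d..d + int i} \<subseteq> ?R r} = card {d\<in>{d. h d \<noteq> 0}. {d..d + int i} \<subseteq> ?R r}"
      by (intro arg_cong[where f = card]) auto
  qed
  also have "\<dots> = (\<Sum>d | h d \<noteq> 0. card {r\<in>{1..m}. {d..d + int i} \<subseteq> ?R r})"
    using sum.swap_restrict[of "{1..m}" "{d. h d \<noteq> 0}" "\<lambda>_ _. 1::nat" "\<lambda>r d. {d..d + int i} \<subseteq> ?R r"]
      finite_support by simp
  also have "\<dots> = (\<Sum>d | h d \<noteq> 0. card {r. 1 \<le> r \<and> (\<forall>e\<in>{d..d + int i}. r \<le> h e)})"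
  proof -
    have "{r\<in>{1..m}. {d..d + int i} \<subseteq> ?R r} = {r. 1 \<le> r \<and> (\<forall>e\<in>{d..d + int i}. r \<le> h e)}" for d
    proof -
      have "r \<le> m" if "\<forall>e\<in>{d..d + int i}. r \<le> h e" for r
        using that m[of r d] by simp
      then show ?thesis by auto
    qed
    then show ?thesis by simp
  qed
  finally show ?thesis .
qed

lemma sum_contiguous_partition: "sum_mset (contiguous_partition h) = (\<Sum>d | h d \<noteq> 0. h d)"
proof -
  have "{r. Suc 0 \<le> r \<and> r \<le> h d} = {1..h d}" for d by auto
  then show ?thesis using excess_contiguous_partition[of 0] by (simp add: excess_def)
qed

end

section \<open>Jordan chains\<close>

text \<open>The columns of a Jordan block with eigenvalue \<open>0\<close> say that \<open>f\<close> kills the first vector of the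
  chain and sends every other one to its predecessor.\<close>

definition jordan_chain :: "('m::ab_group_add \<Rightarrow> 'm) \<Rightarrow> 'm list \<Rightarrow> bool" where
  "jordan_chain f cs \<longleftrightarrow> map f cs = 0 # butlast cs"

lemma jordan_chain_not_Nil: "jordan_chain f cs \<Longrightarrow> cs \<noteq> []"
  by (auto simp: jordan_chain_def)

lemma jordan_chain_hd: "jordan_chain f cs \<Longrightarrow> f (hd cs) = 0"
  by (cases cs) (auto simp: jordan_chain_def)

lemma jordan_chain_tl: "jordan_chain f cs \<Longrightarrow> map f (tl cs) = butlast cs"
  by (cases cs) (auto simp: jordan_chain_def)

lemma jordan_chain_append:
  assumes "jordan_chain f cs" "f x = last cs"
  shows "jordan_chain f (cs @ [x])"
  using assms jordan_chain_not_Nil[OF assms(1)] by (simp add: jordan_chain_def)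

lemma jordan_chain_funpow:
  assumes "jordan_chain f cs" and "f 0 = 0" and "t < length cs"
  shows "(f ^^ i) (cs ! t) = (if i \<le> t then cs ! (t - i) else 0)"
proof (induction i)
  case (Suc i)
  have "f (cs ! s) = (0 # butlast cs) ! s" if "s < length cs" for s
    using that assms(1) unfolding jordan_chain_def by (metis nth_map)
  then have *: "f (cs ! s) = (if s = 0 then 0 else cs ! (s - 1))" if "s < length cs" for s
    using that by (cases s) (auto simp: nth_butlast)
  show ?case
  proof (cases "i \<le> t")
    case True
    then have "(f ^^ Suc i) (cs ! t) = f (cs ! (t - i))" using Suc by simp
    also have "\<dots> = (if t - i = 0 then 0 else cs ! (t - i - 1))"
      using assms(3) by (intro *) simp
    finally show ?thesis using True by auto
  qed (use Suc assms(2) in simp)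
qed simp

text \<open>The zero vector is inserted on both sides because it lies in the image exactly when some
  vector of the chain is killed; it does not change spans.\<close>

lemma jordan_chain_funpow_image:
  assumes "jordan_chain f cs" and "f 0 = 0"
  shows "insert 0 ((f ^^ i) ` set cs) = insert 0 (set (take (length cs - i) cs))"
proof (rule equalityI; rule subsetI)
  fix x assume "x \<in> insert 0 ((f ^^ i) ` set cs)"
  then consider "x = 0" | t where "t < length cs" "x = (f ^^ i) (cs ! t)"
    by (auto simp: in_set_conv_nth)
  then show "x \<in> insert 0 (set (take (length cs - i) cs))"
  proof cases
    case 2
    have "cs ! (t - i) \<in> set (take (length cs - i) cs)" if "i \<le> t"
      using that 2(1) by (auto simp: in_set_conv_nth intro!: exI[of _ "t - i"])
    then show ?thesis using 2 jordan_chain_funpow[OF assms 2(1), of i] by auto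
  qed simp
next
  fix x assume "x \<in> insert 0 (set (take (length cs - i) cs))"
  then consider "x = 0" | t where "t < length cs - i" "x = cs ! t"
    by (auto simp: in_set_conv_nth)
  then show "x \<in> insert 0 ((f ^^ i) ` set cs)"
  proof cases
    case 2
    then have "x = (f ^^ i) (cs ! (t + i))" "t + i < length cs"
      using jordan_chain_funpow[OF assms, of "t + i" i] by auto
    then show ?thesis by auto
  qed simp
qed

lemma distinct_concat_take:
  "distinct (concat css) \<Longrightarrow> distinct (concat (map (\<lambda>cs. take (g cs) cs) css))"
proof (induction css)
  case (Cons cs css)
  have "set (concat (map (\<lambda>cs. take (g cs) cs) css)) \<subseteq> set (concat css)"
    by (auto dest: in_set_takeD)
  then show ?case using Cons by (auto dest: in_set_takeD)
qed simp

section \<open>Matrices in Jordan form and bases of Jordan chains\<close>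

lemma sum_lessThan_add: "sum g {..<n + m} = sum g {..<n} + (\<Sum>i<m. g (n + i))"
  for g :: "nat \<Rightarrow> 'a::comm_monoid_add"
  by (induction m) (simp_all add: add.assoc)

text \<open>The images that a linear map must have on the basis \<open>vs\<close> in order to have matrix \<open>J\<close>; in
  this form the equation between matrices splits along the blocks of \<open>J\<close>.\<close>

definition column_combs :: "('k \<Rightarrow> 'm \<Rightarrow> 'm) \<Rightarrow> 'k mat \<Rightarrow> 'm list \<Rightarrow> 'm::ab_group_add list" where
  "column_combs scale J vs = map (\<lambda>j. \<Sum>i<length vs. scale (J $$ (i, j)) (vs ! i)) [0..<dim_col J]"

locale endomorphism = finite_dimensional_vector_space scale Basis
  for scale :: "'k::field \<Rightarrow> 'm::ab_group_add \<Rightarrow> 'm" and Basis +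
  fixes f :: "'m \<Rightarrow> 'm"
  assumes linear_f: "Vector_Spaces.linear scale scale f"
begin

sublocale f: Vector_Spaces.linear scale scale f by (rule linear_f)

lemma linear_funpow: "Vector_Spaces.linear scale scale (f ^^ i)"
proof (induction i)
  case 0
  then show ?case using module_hom_id by (simp add: id_def)
next
  case (Suc i)
  then show ?case using Vector_Spaces.linear_compose[OF Suc linear_f] by (simp add: comp_def)
qed

lemma matrix_of_eq_iff:
  assumes "ordered_basis scale vs" and "J \<in> carrier_mat (length vs) (length vs)"
  shows "matrix_of scale vs f = J \<longleftrightarrow> map f vs = column_combs scale J vs"
proof -
  have dist: "distinct vs" and ind: "independent (set vs)" and sp: "span (set vs) = UNIV"
    using assms(1) by (auto simp: ordered_basis_def)
  have sum_vs: "(\<Sum>i<length vs. g (vs ! i)) = sum g (set vs)" for g :: "'m \<Rightarrow> 'm"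
    using sum.reindex_bij_betw[OF bij_betw_nth[OF dist refl refl], of g] by simp
  let ?rep = "\<lambda>x. representation (set vs) x"
  have rep: "x = (\<Sum>i<length vs. scale (c i) (vs ! i)) \<longleftrightarrow> (\<forall>i<length vs. ?rep x (vs ! i) = c i)" for x c
  proof
    assume x: "x = (\<Sum>i<length vs. scale (c i) (vs ! i))"
    have "?rep x b = (\<Sum>i<length vs. c i * ?rep (vs ! i) b)" for b
      unfolding x using ind sp
      by (simp add: representation_sum representation_scale)
    moreover have delta: "?rep (vs ! i) (vs ! j) = (if i = j then 1 else 0)" if "i < length vs" "j < length vs" for i j
      using representation_basis[OF ind, of "vs ! i"] that dist by (auto simp: nth_eq_iff_index_eq)
    moreover have "(\<Sum>i<length vs. c i * ?rep (vs ! i) (vs ! j)) = (\<Sum>i<length vs. if i = j then c i else 0)"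
      if "j < length vs" for j
      by (rule sum.cong) (simp_all add: delta that)
    ultimately show "\<forall>i<length vs. ?rep x (vs ! i) = c i" by simp
  next
    assume c: "\<forall>i<length vs. ?rep x (vs ! i) = c i"
    have "x = (\<Sum>b\<in>set vs. scale (?rep x b) b)"
      using sum_representation_eq[OF ind, of x "set vs"] sp by simp
    also have "\<dots> = (\<Sum>i<length vs. scale (?rep x (vs ! i)) (vs ! i))"
      by (rule sum_vs[symmetric])
    also have "\<dots> = (\<Sum>i<length vs. scale (c i) (vs ! i))"
      by (rule sum.cong) (simp_all add: c)
    finally show "x = (\<Sum>i<length vs. scale (c i) (vs ! i))" .
  qed
  have "map f vs = column_combs scale J vs \<longleftrightarrow>
      (\<forall>j<length vs. f (vs ! j) = (\<Sum>i<length vs. scale (J $$ (i, j)) (vs ! i)))"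
    unfolding list_eq_iff_nth_eq using assms(2) by (simp add: column_combs_def cong: sum.cong_simp)
  also have "\<dots> \<longleftrightarrow> (\<forall>j<length vs. \<forall>i<length vs. ?rep (f (vs ! j)) (vs ! i) = J $$ (i, j))"
    by (simp only: rep)
  also have "\<dots> \<longleftrightarrow> matrix_of scale vs f = J"
    using assms(2) unfolding mat_eq_iff by (auto simp: matrix_of_def)
  finally show ?thesis by simp
qed

lemma column_combs_jordan_block:
  assumes "length us = n"
  shows "column_combs scale (jordan_block n a) us = map2 (\<lambda>x y. scale a x + y) us (0 # butlast us)"
proof (rule nth_equalityI)
  show "length (column_combs scale (jordan_block n a) us) = length (map2 (\<lambda>x y. scale a x + y) us (0 # butlast us))"
    using assms by (cases us) (auto simp: column_combs_def)
  fix j assume "j < length (column_combs scale (jordan_block n a) us)"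
  then have j: "j < n" by (simp add: column_combs_def)
  have "(\<Sum>i<n. scale (jordan_block n a $$ (i, j)) (us ! i))
      = (\<Sum>i<n. (if i = j then scale a (us ! i) else 0) + (if Suc i = j then us ! i else 0))"
    using j by (intro sum.cong) auto
  also have "\<dots> = scale a (us ! j) + (0 # butlast us) ! j"
    using j assms by (cases j) (auto simp: sum.distrib nth_butlast)
  finally show "column_combs scale (jordan_block n a) us ! j = map2 (\<lambda>x y. scale a x + y) us (0 # butlast us) ! j"
    using j assms by (simp add: column_combs_def)
qed

lemma column_combs_jordan_matrix_Cons:
  assumes "length us = n" and "length ws = sum_list (map fst n_as)"
  shows "column_combs scale (jordan_matrix ((n, a) # n_as)) (us @ ws) =
    column_combs scale (jordan_block n a) us @ column_combs scale (jordan_matrix n_as) ws"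
proof -
  let ?J = "jordan_matrix ((n, a) # n_as)" and ?m = "length ws"
  have dim: "dim_col ?J = n + ?m" using assms(2) by simp
  have entry: "?J $$ (i, j) =
      (if i < n then if j < n then jordan_block n a $$ (i, j) else 0
       else if j < n then 0 else jordan_matrix n_as $$ (i - n, j - n))"
    if "i < n + ?m" "j < n + ?m" for i j
    using that assms(2) by (simp add: jordan_matrix_Cons)
  have comb: "(\<Sum>i<n + ?m. scale (?J $$ (i, j)) ((us @ ws) ! i)) =
      (if j < n then \<Sum>i<n. scale (jordan_block n a $$ (i, j)) (us ! i)
       else \<Sum>i<?m. scale (jordan_matrix n_as $$ (i, j - n)) (ws ! i))" if "j < n + ?m" for j
    unfolding sum_lessThan_add by (simp add: entry that nth_append assms(1) del: jordan_block_index)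
  have len: "length (us @ ws) = n + ?m" using assms(1) by simp
  show ?thesis (is "?l = ?r")
  proof (rule nth_equalityI)
    show "length ?l = length ?r" using dim assms(2) by (simp add: column_combs_def)
    fix j assume "j < length ?l"
    then have j: "j < n + ?m" using dim by (simp add: column_combs_def)
    then have l: "?l ! j = (\<Sum>i<n + ?m. scale (?J $$ (i, j)) ((us @ ws) ! i))"
      unfolding column_combs_def len dim by simp
    show "?l ! j = ?r ! j"
    proof (cases "j < n")
      case True
      then show ?thesis unfolding l comb[OF j] using assms(1)
        by (simp add: column_combs_def nth_append del: jordan_block_index(1))
    next
      case False
      then show ?thesis unfolding l comb[OF j] using j assms(2)
        by (simp add: column_combs_def nth_append)
    qed
  qed
qed

end

lemma split_by_lengths:
  "length vs = sum_list ns \<Longrightarrow> \<exists>css. concat css = vs \<and> map length css = ns"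
proof (induction ns arbitrary: vs)
  case (Cons n ns)
  obtain css where "concat css = drop n vs" "map length css = ns"
    using Cons.IH[of "drop n vs"] Cons.prems by auto
  then show ?case using Cons.prems by (intro exI[of _ "take n vs # css"]) auto
qed simp

lemma distinct_map_hd:
  "distinct (concat css) \<Longrightarrow> \<forall>cs\<in>set css. cs \<noteq> [] \<Longrightarrow> distinct (map hd css)"
proof (induction css)
  case (Cons cs css)
  have "hd cs \<in> set cs" and sub: "hd ` set css \<subseteq> set (concat css)"
    using Cons.prems(2) by auto
  then have "hd cs \<notin> set (concat css)" using Cons.prems(1) by auto
  then have "hd cs \<notin> set (map hd css)" using sub by auto
  then show ?case using Cons by simp
qed simp

context endomorphism begin

text \<open>A basis of an arbitrary subspace \<open>U\<close> that consists of Jordan chains; the existence proof works its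
  way up through subspaces.\<close>

definition jordan_basis :: "'m list list \<Rightarrow> 'm set \<Rightarrow> bool" where
  "jordan_basis css U \<longleftrightarrow> (\<forall>cs\<in>set css. jordan_chain f cs) \<and> distinct (concat css) \<and>
     independent (set (concat css)) \<and> span (set (concat css)) = U"

text \<open>A Jordan block with eigenvalue \<open>a\<close> acts on its chain as \<open>a\<close> times the identity plus the shift
  to the predecessor, and the blocks act independently of each other.\<close>

lemma map_eq_column_combs_jordan_matrix:
  assumes "list_all2 (\<lambda>cs (n, a). length cs = n) css n_as"
  shows "map f (concat css) = column_combs scale (jordan_matrix n_as) (concat css) \<longleftrightarrow>
    list_all2 (\<lambda>cs (n, a). map f cs = map2 (\<lambda>x y. scale a x + y) cs (0 # butlast cs)) css n_as"
  using assms
proof (induction rule: list_all2_induct)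
  case Nil
  then show ?case by (simp add: column_combs_def jordan_matrix_def)
next
  case (Cons cs css na n_as)
  obtain n a where na: "na = (n, a)" by force
  have len: "length cs = n" using Cons.hyps na by simp
  have len': "length (concat css) = sum_list (map fst n_as)"
    using Cons.hyps(2)
    by (induction rule: list_all2_induct) auto
  have "length (column_combs scale (jordan_block n a) cs) = n"
    by (simp add: column_combs_def)
  then show ?case
    using Cons.IH column_combs_jordan_matrix_Cons[OF len len', of a] column_combs_jordan_block[OF len, of a]
    by (simp add: na len append_eq_append_conv)
qed

lemma scaled_chain_zero: "map2 (\<lambda>x y. scale 0 x + y) cs (0 # butlast cs) = 0 # butlast cs"
  if "cs \<noteq> []"
proof -
  have "map snd (zip cs (0 # butlast cs)) = 0 # butlast cs"
    using that by (intro map_snd_zip) simp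
  then show ?thesis by (simp add: case_prod_unfold)
qed

text \<open>A Jordan type may a priori use blocks with any eigenvalues; nilpotency rules out all but \<open>0\<close>.\<close>

lemma eigenvalue_zero:
  assumes "\<And>x. (f ^^ N) x = 0" "f x = scale a x" "x \<noteq> 0"
  shows "a = 0"
proof -
  have "(f ^^ i) x = scale (a ^ i) x" for i
    by (induction i) (simp_all add: assms(2) f.scale)
  from this[of N] show ?thesis using assms(1,3) by simp
qed

text \<open>Cutting an ordered basis into consecutive pieces of the block sizes gives the chains, and
  concatenating chains gives back the ordered basis.\<close>

lemma is_jordan_type_iff_jordan_basis:
  assumes nil: "\<And>x. (f ^^ N) x = 0"
  shows "is_jordan_type scale f P \<longleftrightarrow> (\<exists>css. jordan_basis css UNIV \<and> P = mset (map length css))"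
proof
  assume "is_jordan_type scale f P"
  then obtain vs n_as where basis: "ordered_basis scale vs" and pos: "0 \<notin> fst ` set n_as"
    and J: "matrix_of scale vs f = jordan_matrix n_as" and P: "P = mset (map fst n_as)"
    unfolding is_jordan_type_def by blast
  have len: "length vs = sum_list (map fst n_as)"
    using arg_cong[OF J, of dim_row] by (simp add: matrix_of_def)
  then obtain css where css: "concat css = vs" "map length css = map fst n_as"
    using split_by_lengths by blast
  then have lens: "list_all2 (\<lambda>cs (n, a). length cs = n) css n_as"
    by (auto simp: list_all2_conv_all_nth case_prod_unfold list_eq_iff_nth_eq)
  have "map f vs = column_combs scale (jordan_matrix n_as) vs"
    using matrix_of_eq_iff[OF basis, of "jordan_matrix n_as"] J len by simp
  then have blocks: "list_all2 (\<lambda>cs (n, a). map f cs = map2 (\<lambda>x y. scale a x + y) cs (0 # butlast cs)) css n_as"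
    using map_eq_column_combs_jordan_matrix[OF lens] css(1) by simp
  have "jordan_chain f cs" if cs_in: "cs \<in> set css" for cs
  proof -
    obtain i where i: "i < length css" "css ! i = cs"
      using cs_in by (auto simp: in_set_conv_nth)
    obtain n a where na: "n_as ! i = (n, a)" by (rule prod.exhaust)
    have i': "i < length n_as" using i lens by (simp add: list_all2_lengthD)
    have "length cs = n" using list_all2_nthD[OF lens i(1)] i(2) na by simp
    moreover have "n \<noteq> 0" using pos nth_mem[OF i'] na by force
    ultimately have ne: "cs \<noteq> []" by auto
    have m: "map f cs = map2 (\<lambda>x y. scale a x + y) cs (0 # butlast cs)"
      using list_all2_nthD[OF blocks i(1)] i(2) na by simp
    then have "f (hd cs) = scale a (hd cs)" using ne by (cases cs) auto
    moreover have "hd cs \<in> set vs" using cs_in hd_in_set[OF ne] css(1) by auto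
    then have "hd cs \<noteq> 0" using basis dependent_zero unfolding ordered_basis_def by metis
    ultimately have "a = 0" using eigenvalue_zero nil by blast
    then show ?thesis using m scaled_chain_zero[OF ne] by (simp add: jordan_chain_def)
  qed
  then have "jordan_basis css UNIV"
    using basis css(1) by (simp add: jordan_basis_def ordered_basis_def)
  then show "\<exists>css. jordan_basis css UNIV \<and> P = mset (map length css)"
    using css(2) P by metis
next
  assume "\<exists>css. jordan_basis css UNIV \<and> P = mset (map length css)"
  then obtain css where css: "jordan_basis css UNIV" "P = mset (map length css)" by blast
  let ?n_as = "map (\<lambda>cs. (length cs, 0::'k)) css"
  have basis: "ordered_basis scale (concat css)"
    using css(1) by (simp add: jordan_basis_def ordered_basis_def)
  have fst: "map fst ?n_as = map length css" by simp
  have lens: "list_all2 (\<lambda>cs (n, a). length cs = n) css ?n_as"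
    by (simp add: list_all2_conv_all_nth)
  have chain: "jordan_chain f cs" if "cs \<in> set css" for cs
    using css(1) that by (simp add: jordan_basis_def)
  have "map f cs = map2 (\<lambda>x y. scale 0 x + y) cs (0 # butlast cs)" if "cs \<in> set css" for cs
    using chain[OF that] scaled_chain_zero[OF jordan_chain_not_Nil[OF chain[OF that]]]
    by (simp add: jordan_chain_def)
  then have "list_all2 (\<lambda>cs (n, a). map f cs = map2 (\<lambda>x y. scale a x + y) cs (0 # butlast cs)) css ?n_as"
    by (simp only: list_all2_map2 prod.case list_all2_same) blast
  then have "map f (concat css) = column_combs scale (jordan_matrix ?n_as) (concat css)"
    using map_eq_column_combs_jordan_matrix[OF lens] by simp
  then have "matrix_of scale (concat css) f = jordan_matrix ?n_as"
    using matrix_of_eq_iff[OF basis, of "jordan_matrix ?n_as"]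
      jordan_matrix_carrier[of ?n_as, unfolded fst] length_concat[of css] by simp
  moreover have "0 \<notin> fst ` set ?n_as" using chain jordan_chain_not_Nil by fastforce
  ultimately show "is_jordan_type scale f P"
    unfolding is_jordan_type_def using basis css(2) fst by metis
qed

text \<open>The power \<open>f\<^sup>i\<close> shifts each chain down by \<open>i\<close> places, so its image is spanned by the chains
  shortened by \<open>i\<close>.\<close>

lemma dim_range_funpow:
  assumes "jordan_basis css UNIV"
  shows "dim (range (f ^^ i)) = excess (mset (map length css)) i"
proof -
  have chains: "\<And>cs. cs \<in> set css \<Longrightarrow> jordan_chain f cs" and dist: "distinct (concat css)"
    and ind: "independent (set (concat css))" and sp: "span (set (concat css)) = UNIV"
    using assms by (auto simp: jordan_basis_def)
  let ?ts = "concat (map (\<lambda>cs. take (length cs - i) cs) css)"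
  interpret fi: Vector_Spaces.linear scale scale "f ^^ i" by (rule linear_funpow)
  have "insert 0 ((f ^^ i) ` set (concat css)) = insert 0 (\<Union>cs\<in>set css. insert 0 ((f ^^ i) ` set cs))"
    by auto
  also have "\<dots> = insert 0 (\<Union>cs\<in>set css. insert 0 (set (take (length cs - i) cs)))"
    using jordan_chain_funpow_image[OF chains f.zero] by simp
  also have "\<dots> = insert 0 (set ?ts)" by auto
  finally have "span ((f ^^ i) ` set (concat css)) = span (set ?ts)"
    by (metis span_insert_0)
  moreover have "range (f ^^ i) = span ((f ^^ i) ` set (concat css))"
    using sp by (simp add: fi.span_image)
  moreover have "independent (set ?ts)"
    by (rule independent_mono[OF ind]) (auto dest: in_set_takeD)
  ultimately have "dim (range (f ^^ i)) = card (set ?ts)"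
    using dim_span_eq_card_independent by metis
  also have "\<dots> = length ?ts"
    by (rule distinct_card[OF distinct_concat_take[OF dist]])
  also have "\<dots> = excess (mset (map length css)) i"
    unfolding excess_mset length_concat by (simp add: comp_def)
  finally show ?thesis .
qed

section \<open>Existence and uniqueness of the Jordan type\<close>

lemma independent_Un:
  assumes "independent S" "independent T" and "span S \<inter> span T \<subseteq> {0}"
  shows "independent (S \<union> T)"
proof (rule independent_if_scalars_zero)
  have fin: "finite S" "finite T" using assms finiteI_independent by auto
  then show "finite (S \<union> T)" by simp
  have disj: "S \<inter> T = {}"
    using assms dependent_zero span_base by blast
  fix c x assume sum: "(\<Sum>v\<in>S \<union> T. scale (c v) v) = 0" and x: "x \<in> S \<union> T"
  let ?s = "\<Sum>v\<in>S. scale (c v) v" and ?t = "\<Sum>v\<in>T. scale (c v) v"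
  have st: "?s = - ?t"
    using sum sum.union_disjoint[OF fin disj, of "\<lambda>v. scale (c v) v"] by (simp add: eq_neg_iff_add_eq_0)
  have "?s \<in> span S" "?t \<in> span T" by (intro span_sum span_scale span_base; assumption)+
  then have "?s = 0" using st assms(3) span_neg by auto
  then have "?s = 0" "?t = 0" using st by auto
  then show "c x = 0"
    using x independentD[OF assms(1) fin(1) order_refl] independentD[OF assms(2) fin(2) order_refl] by blast
qed

lemma independent_if_independent_image:
  assumes ind: "independent (f ` S)" and inj: "inj_on f S"
  shows "independent S"
proof (rule independent_if_scalars_zero)
  show fin: "finite S" using finiteI_independent[OF ind] inj finite_imageD by blast
  fix c x assume sum: "(\<Sum>v\<in>S. scale (c v) v) = 0" and x: "x \<in> S"
  let ?c = "\<lambda>w. c (inv_into S f w)"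
  have "(\<Sum>w\<in>f ` S. scale (?c w) w) = (\<Sum>v\<in>S. scale (c v) (f v))"
    by (simp add: sum.reindex[OF inj] inv_into_f_f[OF inj])
  also have "\<dots> = f (\<Sum>v\<in>S. scale (c v) v)" by (simp add: f.sum f.scale)
  also have "\<dots> = 0" using sum by (simp add: f.zero)
  finally have "?c (f x) = 0"
    using independentD[OF ind _ order_refl, of ?c "f x"] fin x by blast
  then show "c x = 0" using inj x by simp
qed

text \<open>Every chain of \<open>f ` U\<close> is lengthened by a preimage of its last vector. The first vectors of
  the chains lie in the kernel of \<open>f\<close> on \<open>U\<close>; completing them to a basis of this kernel adds chains
  of length one. All other vectors of the lengthened chains are mapped bijectively onto the old
  basis of \<open>f ` U\<close>, so the result is a basis of \<open>U\<close>, as in the proof of the rank-nullity theorem.\<close>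

lemma extend_jordan_basis:
  assumes U: "subspace U" "f ` U \<subseteq> U" and css: "jordan_basis css (f ` U)"
  shows "\<exists>css'. jordan_basis css' U"
proof -
  have chains: "\<And>cs. cs \<in> set css \<Longrightarrow> jordan_chain f cs" and dist: "distinct (concat css)"
    and ind: "independent (set (concat css))" and sp: "span (set (concat css)) = f ` U"
    using css by (auto simp: jordan_basis_def)
  have ne: "\<And>cs. cs \<in> set css \<Longrightarrow> cs \<noteq> []" using chains jordan_chain_not_Nil by blast
  have in_image: "x \<in> f ` U" if "x \<in> set (concat css)" for x
    using span_base[OF that] sp by simp
  define g where "g = inv_into U f"
  have g: "g y \<in> U" "f (g y) = y" if "y \<in> f ` U" for y
    using that by (auto simp: g_def inv_into_into f_inv_into_f)
  have g_last: "g (last cs) \<in> U" "f (g (last cs)) = last cs" if "cs \<in> set css" for cs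
  proof -
    have "last cs \<in> set (concat css)" using that last_in_set[OF ne[OF that]] by auto
    then show "g (last cs) \<in> U" "f (g (last cs)) = last cs" using g in_image by blast+
  qed
  let ?Z = "{x \<in> U. f x = 0}" and ?H = "map hd css"
    and ?G = "concat (map (\<lambda>cs. tl cs @ [g (last cs)]) css)"
  have Z: "subspace ?Z"
    using subspace_inter[OF U(1) f.subspace_kernel] by (simp add: Collect_conj_eq)
  have hd_in: "set ?H \<subseteq> set (concat css)" using hd_in_set[OF ne] by auto
  have "f x = 0" if "x \<in> set ?H" for x using that chains jordan_chain_hd by auto
  then have "set ?H \<subseteq> ?Z" using in_image hd_in U(2) by blast
  moreover have "independent (set ?H)" by (rule independent_mono[OF ind hd_in])
  ultimately obtain B where B: "set ?H \<subseteq> B" "B \<subseteq> ?Z" "independent B" "?Z \<subseteq> span B"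
    by (rule maximal_independent_subset_extend)
  have "finite (B - set ?H)" using B(3) finiteI_independent by blast
  then obtain ks where ks: "set ks = B - set ?H" "distinct ks"
    using finite_distinct_list by blast
  let ?css' = "map (\<lambda>cs. cs @ [g (last cs)]) css @ map (\<lambda>k. [k]) ks"
  \<comment> \<open>\<open>?G\<close> lists the lengthened chains without their first vectors: a lift of the old basis.\<close>
  have fG: "map f ?G = concat css"
    using chains g_last
  proof (induction css)
    case (Cons cs css)
    then show ?case using jordan_chain_tl[of f cs] jordan_chain_not_Nil[of f cs] by simp
  qed simp
  \<comment> \<open>Up to order, the new basis consists of this lift and of a basis of the kernel.\<close>
  have "mset (concat (map (\<lambda>cs. cs @ [g (last cs)]) css)) = mset ?H + mset ?G"
    using ne
  proof (induction css)
    case (Cons cs css)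
    then show ?case by (cases cs) auto
  qed simp
  then have perm: "mset (concat ?css') = mset (?H @ ?G @ ks)" by simp
  have "x \<in> set (concat css)" if "cs \<in> set css" "x \<in> set (tl cs)" for x cs
    using that list.set_sel(2)[OF ne] by auto
  then have setG: "set ?G \<subseteq> U"
    using in_image U(2) g_last(1) by (simp add: subset_iff) blast
  have distG: "distinct ?G" and injG: "inj_on f (set ?G)"
    using dist unfolding fG[symmetric] distinct_map by blast+
  have fsetG: "f ` set ?G = set (concat css)"
    using arg_cong[OF fG, of set] by (simp only: set_map)
  have indfG: "independent (f ` set ?G)" unfolding fsetG by (rule ind)
  have inj_span: "inj_on f (span (set ?G))"
    using f.inj_on_span_iff_independent_image[OF indfG] injG by blast
  have indG: "independent (set ?G)" by (rule independent_if_independent_image[OF indfG injG])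
  have spanB: "span B \<subseteq> ?Z" by (rule span_minimal[OF B(2) Z])
  have "x = 0" if "x \<in> span (set ?G)" "x \<in> span B" for x
    using inj_onD[OF inj_span _ that(1) span_zero] that(2) spanB f.zero by auto
  then have trivial: "span (set ?G) \<inter> span B \<subseteq> {0}" by blast
  have set': "set (concat ?css') = set ?G \<union> B"
    using arg_cong[OF perm, of set_mset] ks(1) B(1) by auto
  have "set ?G \<inter> B = {}"
    using trivial indG dependent_zero span_base by blast
  moreover have "distinct ?H" by (rule distinct_map_hd[OF dist]) (use ne in blast)
  ultimately have "distinct (?H @ ?G @ ks)" using distG ks B(1) by auto
  then have dist': "distinct (concat ?css')" using mset_eq_imp_distinct_iff[OF perm] by blast
  have "U \<subseteq> span (set ?G \<union> B)"
  proof
    fix u assume u: "u \<in> U"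
    have "f u \<in> f ` span (set ?G)"
      unfolding f.span_image[symmetric] fsetG sp using u by (rule imageI)
    then obtain y where y: "y \<in> span (set ?G)" "f u = f y" by (elim imageE)
    have "y \<in> U" using y(1) span_minimal[OF setG U(1)] by blast
    then have "u - y \<in> ?Z" using u y(2) subspace_diff[OF U(1)] by (simp add: f.diff)
    then have "u - y \<in> span B" using B(4) by blast
    then have "y + (u - y) \<in> span (set ?G \<union> B)"
      using y(1) span_mono[of "set ?G" "set ?G \<union> B"] span_mono[of B "set ?G \<union> B"]
      by (intro span_add) blast+
    then show "u \<in> span (set ?G \<union> B)" by simp
  qed
  moreover have "span (set ?G \<union> B) \<subseteq> U"
    using setG B(2) U(1) by (intro span_minimal) auto
  ultimately have "span (set (concat ?css')) = U" unfolding set' by blast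
  moreover have "independent (set (concat ?css'))"
    unfolding set' by (rule independent_Un[OF indG B(3) trivial])
  moreover have "jordan_chain f (cs @ [g (last cs)])" if "cs \<in> set css" for cs
    using that chains g_last(2) by (blast intro: jordan_chain_append)
  moreover have "jordan_chain f [k]" if "k \<in> set ks" for k
    using that ks(1) B(2) by (auto simp: jordan_chain_def)
  ultimately have "\<forall>cs\<in>set ?css'. jordan_chain f cs" by auto
  moreover note \<open>span (set (concat ?css')) = U\<close> \<open>independent (set (concat ?css'))\<close>
  ultimately show ?thesis using dist' unfolding jordan_basis_def by blast
qed

text \<open>Descending induction on \<open>i\<close> along the images of \<open>f\<^sup>i\<close>, from the zero space up to the whole space.\<close>

lemma jordan_basis_exists:
  assumes nil: "\<And>x. (f ^^ N) x = 0"
  shows "\<exists>css. jordan_basis css UNIV"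
proof -
  have "\<exists>css. jordan_basis css (range (f ^^ i))" if "i \<le> N" for i
    using that
  proof (induction rule: inc_induct)
    case base
    have "range (f ^^ N) = {0}" using nil by auto
    then show ?case by (intro exI[of _ "[]"]) (simp add: jordan_basis_def independent_empty)
  next
    case (step i)
    interpret fi: Vector_Spaces.linear scale scale "f ^^ i" by (rule linear_funpow)
    have img: "f ` range (f ^^ i) = range (f ^^ Suc i)" by (simp add: image_image)
    have "subspace (range (f ^^ i))" using fi.subspace_image by simp
    moreover have "f ` range (f ^^ i) \<subseteq> range (f ^^ i)"
      by (auto simp: funpow_swap1)
    moreover obtain css where "jordan_basis css (f ` range (f ^^ i))"
      using step.IH unfolding img by blast
    ultimately show ?case by (rule extend_jordan_basis)
  qed
  from this[of 0] show ?thesis by simp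
qed

text \<open>The ranks of the powers of \<open>f\<close> determine the excesses, hence the partition, whatever basis is chosen.\<close>

theorem jordan_type_nilpotent:
  assumes nil: "\<And>x. (f ^^ N) x = 0"
  shows "0 \<notin># jordan_type scale f" and "excess (jordan_type scale f) i = dim (range (f ^^ i))"
proof -
  have types: "0 \<notin># P \<and> (\<forall>i. excess P i = dim (range (f ^^ i)))" if P: "is_jordan_type scale f P" for P
  proof -
    obtain css where "jordan_basis css UNIV" "P = mset (map length css)"
      using P is_jordan_type_iff_jordan_basis[OF nil] by blast
    moreover have "0 \<notin># P" using P by (auto simp: is_jordan_type_def)
    ultimately show ?thesis using dim_range_funpow by simp
  qed
  obtain P where P: "is_jordan_type scale f P"
    using jordan_basis_exists[OF nil] unfolding is_jordan_type_iff_jordan_basis[OF nil] by blast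
  have unique: "P' = P" if P': "is_jordan_type scale f P'" for P'
  proof (rule excess_inject)
    show "0 \<notin># P'" "0 \<notin># P" using types[OF P] types[OF P'] by blast+
    show "excess P' i = excess P i" for i using types[OF P] types[OF P'] by metis
  qed
  have "jordan_type scale f = P"
    unfolding jordan_type_def by (rule the_equality[of "is_jordan_type scale f", OF P unique])
  then show "0 \<notin># jordan_type scale f" "excess (jordan_type scale f) i = dim (range (f ^^ i))"
    using types[OF P] by simp_all
qed

end

section \<open>Endomorphisms of degree one\<close>

locale graded_endomorphism = endomorphism scale Basis f
  for scale :: "'k::field \<Rightarrow> 'm::ab_group_add \<Rightarrow> 'm" and Basis and f +
  fixes M :: "int \<Rightarrow> 'm set"
  assumes subspace_M: "subspace (M d)"
    and direct_sum_M: "internal_direct_sum M"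
    and degree_one: "x \<in> M d \<Longrightarrow> f x \<in> M (d + 1)"
begin

abbreviation h :: "int \<Rightarrow> nat" where "h d \<equiv> dim (M d)"

lemma homogeneous_decomposition:
  "\<exists>u. (\<forall>d. u d \<in> M d) \<and> finite {d. u d \<noteq> 0} \<and> x = (\<Sum>d | u d \<noteq> 0. u d)"
  using direct_sum_M unfolding internal_direct_sum_def by blast

lemma homogeneous_components_zero:
  assumes "\<And>d. u d \<in> M d" "finite {d. u d \<noteq> 0}" "(\<Sum>d | u d \<noteq> 0. u d) = 0"
  shows "u d = 0"
proof -
  define decomposes where
    "decomposes v \<longleftrightarrow> (\<forall>d. v d \<in> M d) \<and> finite {d. v d \<noteq> 0} \<and> 0 = (\<Sum>d | v d \<noteq> 0. v d)" for v
  have "\<exists>!v. decomposes v"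
    using direct_sum_M unfolding internal_direct_sum_def decomposes_def by blast
  moreover have "decomposes u" using assms by (simp add: decomposes_def)
  moreover have "decomposes (\<lambda>_. 0)"
    using subspace_0[OF subspace_M] by (simp add: decomposes_def)
  ultimately have "u = (\<lambda>_. 0)" by blast
  then show ?thesis by simp
qed

lemma components_disjoint:
  assumes "v \<in> M d" "v \<in> M e" "d \<noteq> e"
  shows "v = 0"
proof -
  \<comment> \<open>A nonzero vector in two components would give a second decomposition of \<open>0\<close>.\<close>
  let ?u = "(\<lambda>_. 0)(d := v, e := - v)"
  have sub: "{i. ?u i \<noteq> 0} \<subseteq> {d, e}" by auto
  have "?u i \<in> M i" for i
    using assms(1,2) subspace_0[OF subspace_M] subspace_neg[OF subspace_M] by simp
  moreover have "finite {i. ?u i \<noteq> 0}" using sub finite_subset by blast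
  moreover have "(\<Sum>i | ?u i \<noteq> 0. ?u i) = (\<Sum>i\<in>{d, e}. ?u i)"
    by (rule sum.mono_neutral_left) (use sub in auto)
  then have "(\<Sum>i | ?u i \<noteq> 0. ?u i) = 0" using assms(3) by simp
  ultimately have "?u d = 0" by (rule homogeneous_components_zero)
  then show ?thesis using assms(3) by simp
qed

text \<open>The union of bases of the components is a basis of the whole space. Finite dimension therefore
  makes all but finitely many components zero.\<close>

lemma dim_components:
  shows finite_support: "finite {d. h d \<noteq> 0}" and dim_UNIV_eq_sum: "dim UNIV = (\<Sum>d | h d \<noteq> 0. h d)"
proof -
  have "\<forall>d. \<exists>B. B \<subseteq> M d \<and> independent B \<and> M d \<subseteq> span B \<and> card B = h d"
    using basis_exists by metis
  then obtain B where B: "\<And>d. B d \<subseteq> M d" "\<And>d. independent (B d)" "\<And>d. M d \<subseteq> span (B d)"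
    "\<And>d. card (B d) = h d" by metis
  have finB: "finite (B d)" for d using B(2) finiteI_independent by blast
  have deg_unique: "d = e" if "v \<in> B d" "v \<in> B e" for v d e
    using that components_disjoint[of v d e] B(1) B(2)[of d] dependent_zero[of "B d"] by blast
  \<comment> \<open>Grouping a linear relation by degree leaves a relation in each component.\<close>
  define deg where "deg v = (SOME d. v \<in> B d)" for v
  have deg: "deg v = d" if "v \<in> B d" for v d
    unfolding deg_def by (rule some_equality[where P = "\<lambda>d. v \<in> B d"]) (use that deg_unique in blast)+
  have ind: "independent (\<Union>d. B d)"
    unfolding independent_explicit_finite_subsets
  proof (intro allI impI ballI)
    fix S c v
    assume S: "S \<subseteq> (\<Union>d. B d)" "finite S" and sum0: "(\<Sum>v\<in>S. scale (c v) v) = 0" and v: "v \<in> S"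
    let ?S = "\<lambda>d. {v \<in> S. deg v = d}"
    let ?u = "\<lambda>d. \<Sum>v\<in>?S d. scale (c v) v"
    have SB: "?S d \<subseteq> B d" for d using S(1) deg by auto
    have "?S d = {}" if "d \<notin> deg ` S" for d using that by auto
    then have sub: "{d. ?u d \<noteq> 0} \<subseteq> deg ` S" by (metis (mono_tags, lifting) mem_Collect_eq subsetI sum.empty)
    have "?u d \<in> M d" for d
      using SB[of d] B(1)[of d] by (intro subspace_sum[OF subspace_M] subspace_scale[OF subspace_M]) blast
    moreover have "finite {d. ?u d \<noteq> 0}" using sub S(2) finite_subset by blast
    moreover have "(\<Sum>d | ?u d \<noteq> 0. ?u d) = 0"
    proof -
      have "(\<Sum>d | ?u d \<noteq> 0. ?u d) = (\<Sum>d\<in>deg ` S. ?u d)"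
        by (rule sum.mono_neutral_left) (use sub S(2) in auto)
      also have "\<dots> = (\<Sum>v\<in>S. scale (c v) v)" by (rule sum.image_gen[OF S(2), symmetric])
      finally show ?thesis using sum0 by simp
    qed
    ultimately have "?u (deg v) = 0" by (rule homogeneous_components_zero)
    then show "c v = 0"
      using independentD[OF B(2) _ SB] S(2) v by simp
  qed
  have fin: "finite (\<Union>d. B d)" by (rule finiteI_independent[OF ind])
  have support: "{d. h d \<noteq> 0} = {d. B d \<noteq> {}}"
    using B(4) finB by (metis card_eq_0_iff)
  have "{d. B d \<noteq> {}} \<subseteq> deg ` (\<Union>d. B d)" using deg by force
  then show fin_support: "finite {d. h d \<noteq> 0}" unfolding support using fin finite_subset by blast
  have "x \<in> span (\<Union>d. B d)" for x
  proof -
    obtain u where u: "\<And>d. u d \<in> M d" "x = (\<Sum>d | u d \<noteq> 0. u d)"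
      using homogeneous_decomposition[of x] by blast
    have "u d \<in> span (\<Union>d. B d)" for d
      using u(1) B(3) span_mono[of "B d" "\<Union>d. B d"] by blast
    then show ?thesis unfolding u(2) by (intro span_sum)
  qed
  then have "dim UNIV = card (\<Union>d. B d)"
    by (intro basis_card_eq_dim[symmetric] ind) auto
  also have "(\<Union>d. B d) = (\<Union>d\<in>{d. h d \<noteq> 0}. B d)" using support by auto
  also have "card \<dots> = (\<Sum>d | h d \<noteq> 0. card (B d))"
    by (rule card_UN_disjoint[OF fin_support]) (use finB deg_unique in blast)+
  finally show "dim UNIV = (\<Sum>d | h d \<noteq> 0. h d)" by (simp add: B(4))
qed

lemma funpow_degree: "x \<in> M d \<Longrightarrow> (f ^^ i) x \<in> M (d + int i)"
proof (induction i)
  case (Suc i)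
  then show ?case using degree_one[of "(f ^^ i) x" "d + int i"] by (simp add: algebra_simps)
qed simp

text \<open>The map \<open>f\<^sup>i\<close> on the component of degree \<open>d\<close> passes through the component of degree \<open>e\<close>.\<close>

lemma dim_funpow_component_le:
  assumes "e \<in> {d..d + int i}"
  shows "dim ((f ^^ i) ` M d) \<le> h e"
proof -
  interpret pair: finite_dimensional_vector_space_pair_1 scale Basis scale ..
  define k where "k = nat (e - d)"
  have k: "k \<le> i" "e = d + int k" using assms by (auto simp: k_def)
  have "f ^^ i = (f ^^ (i - k)) \<circ> (f ^^ k)" using k(1) by (simp flip: funpow_add)
  then have "(f ^^ i) ` M d = (f ^^ (i - k)) ` ((f ^^ k) ` M d)" by (simp add: image_comp)
  then have "dim ((f ^^ i) ` M d) \<le> dim ((f ^^ k) ` M d)"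
    using pair.dim_image_le[OF linear_funpow] by simp
  also have "\<dots> \<le> h e" unfolding k(2) by (rule dim_subset) (auto intro: funpow_degree)
  finally show ?thesis .
qed

lemma dim_range_funpow_le:
  "dim (range (f ^^ i)) \<le> (\<Sum>d | h d \<noteq> 0. card {r. 1 \<le> r \<and> (\<forall>e\<in>{d..d + int i}. r \<le> h e)})"
proof -
  interpret fi: Vector_Spaces.linear scale scale "f ^^ i" by (rule linear_funpow)
  let ?N = "\<lambda>d. (f ^^ i) ` M d" and ?D = "{d. h d \<noteq> 0}"
  have "\<forall>d. \<exists>C. C \<subseteq> ?N d \<and> independent C \<and> ?N d \<subseteq> span C \<and> card C = dim (?N d)"
    using basis_exists by metis
  then obtain C where C: "\<And>d. independent (C d)" "\<And>d. ?N d \<subseteq> span (C d)" "\<And>d. card (C d) = dim (?N d)"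
    by metis
  have "(f ^^ i) x \<in> span (\<Union>d\<in>?D. C d)" for x
  proof -
    obtain u where u: "\<And>d. u d \<in> M d" "x = (\<Sum>d | u d \<noteq> 0. u d)"
      using homogeneous_decomposition[of x] by blast
    have "(f ^^ i) (u d) \<in> span (\<Union>d\<in>?D. C d)" if "u d \<noteq> 0" for d
    proof -
      have "d \<in> ?D" using u(1)[of d] that by auto
      then show ?thesis using u(1)[of d] C(2)[of d] span_mono[of "C d" "\<Union>d\<in>?D. C d"] by blast
    qed
    then show ?thesis unfolding u(2) fi.sum by (intro span_sum) simp
  qed
  then have "dim (range (f ^^ i)) \<le> card (\<Union>d\<in>?D. C d)"
    by (intro dim_le_card) (use finite_support C(1) finiteI_independent in auto)
  also have "\<dots> \<le> (\<Sum>d\<in>?D. card (C d))" by (rule card_UN_le[OF finite_support])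
  also have "\<dots> \<le> (\<Sum>d\<in>?D. card {r. 1 \<le> r \<and> (\<forall>e\<in>{d..d + int i}. r \<le> h e)})"
  proof (rule sum_mono)
    fix d
    let ?R = "{r. 1 \<le> r \<and> (\<forall>e\<in>{d..d + int i}. r \<le> h e)}"
    have "{1..dim (?N d)} \<subseteq> ?R" using dim_funpow_component_le le_trans by fastforce
    moreover have "?R \<subseteq> {..h d}" by auto
    then have "finite ?R" using finite_subset by blast
    ultimately have "card {1..dim (?N d)} \<le> card ?R" by (intro card_mono)
    then show "card (C d) \<le> card ?R" using C(3) by simp
  qed
  finally show ?thesis .
qed

text \<open>A window with one more degree than there are nonzero components meets a zero component, so the
  bound on the rank vanishes.\<close>

lemma nilpotent: "(f ^^ card {d. h d \<noteq> 0}) x = 0"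
proof -
  let ?D = "{d. h d \<noteq> 0}"
  have empty: "{r. 1 \<le> r \<and> (\<forall>e\<in>{d..d + int (card ?D)}. r \<le> h e)} = {}" for d
  proof -
    have "\<not> {d..d + int (card ?D)} \<subseteq> ?D"
    proof
      assume "{d..d + int (card ?D)} \<subseteq> ?D"
      from card_mono[OF finite_support this] show False by simp
    qed
    then obtain e where e: "e \<in> {d..d + int (card ?D)}" "h e = 0" by blast
    have False if "1 \<le> r" "\<forall>e\<in>{d..d + int (card ?D)}. r \<le> h e" for r
      using bspec[OF that(2) e(1)] that(1) unfolding e(2) by linarith
    then show ?thesis by blast
  qed
  have "dim (range (f ^^ card ?D)) = 0"
    using dim_range_funpow_le[of "card ?D"] unfolding empty by (simp del: dim_eq_0)
  then show ?thesis by auto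
qed

theorem jordan_type_le_contiguous_partition:
  shows "partition_of (dim UNIV) (jordan_type scale f)"
    and "partition_of (dim UNIV) (contiguous_partition h)"
    and "dominance_le (jordan_type scale f) (contiguous_partition h)"
proof -
  note jt = jordan_type_nilpotent[OF nilpotent]
  show "partition_of (dim UNIV) (jordan_type scale f)"
    using jt(1) jt(2)[of 0] by (simp add: partition_of_def excess_def)
  show "partition_of (dim UNIV) (contiguous_partition h)"
    using zero_notin_contiguous_partition[OF finite_support] sum_contiguous_partition[OF finite_support]
      dim_UNIV_eq_sum by (simp add: partition_of_def)
  show "dominance_le (jordan_type scale f) (contiguous_partition h)"
  proof (rule dominance_le_if_excess_le)
    fix i
    show "excess (jordan_type scale f) i \<le> excess (contiguous_partition h) i"
      unfolding jt(2) excess_contiguous_partition[OF finite_support] by (rule dim_range_funpow_le)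
  qed
qed

end

theorem theorem2p20:
  fixes scaleA :: "'k::field \<Rightarrow> 'a::comm_ring_1 \<Rightarrow> 'a"
    and A :: "nat \<Rightarrow> 'a set"
    and smult :: "'a \<Rightarrow> 'm::ab_group_add \<Rightarrow> 'm"
    and scaleM :: "'k \<Rightarrow> 'm \<Rightarrow> 'm"
    and M :: "int \<Rightarrow> 'm set"
    and l :: 'a
  assumes "finite_graded_module scaleA A smult scaleM M"
    and "l \<in> A 1"
  defines "P \<equiv> jordan_type scaleM (smult l)"
    and "Q \<equiv> contiguous_partition (hilbert_function scaleM M)"
    and "n \<equiv> vector_space.dim scaleM (UNIV :: 'm set)"
  shows "partition_of n P \<and> partition_of n Q \<and> dominance_le P Q"
proof -
  interpret M: finite_graded_module scaleA A smult scaleM M by (rule assms(1))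
  obtain S where S: "finite S" "M.V.span S = UNIV" using M.finite_dim_module by blast
  obtain B where B: "B \<subseteq> S" "M.V.independent B" "S \<subseteq> M.V.span B"
    using M.V.maximal_independent_subset[of S] by blast
  have "M.V.span B = UNIV" using M.V.span_minimal[OF B(3)] S(2) by auto
  then interpret V: finite_dimensional_vector_space scaleM B
    using B finite_subset[OF B(1) S(1)] by unfold_locales
  have commute: "smult l (scaleM c x) = scaleM c (smult l x)" for c x
  proof -
    have "smult l (scaleM c x) = smult l (smult (scaleA c 1) x)"
      using M.scaleM_compat[of c 1 x] by simp
    also have "\<dots> = smult (scaleA c (1 * l)) x"
      using M.scaleA_mult[of c 1 l] by (simp add: mult.commute)
    also have "\<dots> = scaleM c (smult l x)" using M.scaleM_compat[of c l x] by simp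
    finally show ?thesis .
  qed
  \<comment> \<open>The hypothesis \<open>l \<in> A 1\<close> makes multiplication by \<open>l\<close> a map of degree one.\<close>
  interpret G: graded_endomorphism scaleM B "smult l" M
    using M.subspace_module_component M.direct_sum_module M.smult_component[OF assms(2)] commute
    by unfold_locales (auto simp: add.commute M.AM.scale_right_distrib)
  have "hilbert_function scaleM M = (\<lambda>d. M.V.dim (M d))"
    by (simp add: hilbert_function_def fun_eq_iff)
  then show ?thesis
    unfolding P_def Q_def n_def using G.jordan_type_le_contiguous_partition by simp
qed

end
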